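(* Let $\mathbf L=\sum_{k=1}^J\hat p^l_{k,N}\in(0,1)$ and $\mathbf U=\sum_{k=1}^J\hat p^u_{k,N}>1$, where $\hat p^l_{j,N}=\max\{0,\hat p_{j,N}-\hat r_{j,N}\}$ and $\hat p^u_{j,N}=\min\{1,\hat p_{j,N}+\hat r_{j,N}\}$. Let $P^l_N$ and $P^{u-l}_N$ be the probability measures on $\Xi$ given, for $j=1,\dots,J$, by $$P^l_N(\xi=\xi^j)=\frac{\hat p^l_{j,N}}{\mathbf L},\qquad P^{u-l}_N(\xi=\xi^j)=\frac{\hat p^u_{j,N}-\hat p^l_{j,N}}{\mathbf U-\mathbf L}.$$ Then, for every $V_N:\mathcal S\to\mathbb R$ and any $s\in\mathcal S$ and $a\in\mathcal A$, $$\sup_{P\in\mathfrak P(\hat P_N,\hat r_N)}\mathbb E_P\left[\mathcal C(s,a,\xi)+\gamma V_N(g(s,a,\xi))\right]=\mathbf L\,\mathbb E_{P^l_N}\left[\mathcal C(s,a,\xi)+\gamma V_N(g(s,a,\xi))\right]+(1-\mathbf L)\,\mathrm{CVaR}^{(\mathbf U-1)/(\mathbf U-\mathbf L)}_{P^{u-l}_N}\left[\mathcal C(s,a,\xi)+\gamma V_N(g(s,a,\xi))\right].$$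
   Context: $\mathcal S\subseteq\mathbb R^m$ and $\mathcal A\subseteq\mathbb R^n$ are nonempty closed sets; $\Xi=\{\xi^1,\dots,\xi^J\}\subseteq\mathbb R^k$ is a finite set of $J$ distinct points; $\mathscr P(\Xi)$ is the set of probability measures on $\Xi$, identified with the probability vectors $\{P=(p_j)_{j=1}^J\in[0,1]^J:\sum_{j=1}^Jp_j=1\}$ via $p_j=P(\xi=\xi^j)$. $\mathcal C:\mathcal S\times\mathcal A\times\Xi\to\mathbb R$ is the cost, $g:\mathcal S\times\mathcal A\times\Xi\to\mathcal S$ the transition function, $\gamma\in[0,1)$ the discount factor. Bayesian ambiguity set: prior parameters $\tau_{j,0}>1$ ($j=1,\dots,J$) are given; for observations $\hat\xi_1,\dots,\hat\xi_N\in\Xi$ put $\tau_{j,N}=\tau_{j,0}+\sum_{i=1}^N\mathbf 1_{\{\hat\xi_i=\xi^j\}}$. Fix $\alpha\in(0,1)$, $\alpha'=\alpha/J$, and let $z_{1-\alpha'/2}$ be the $(1-\alpha'/2)$-quantile of the standard normal distribution. Then $$\hat p_{j,N}=\frac{\tau_{j,N}-1}{\sum_{k=1}^J\tau_{k,N}-J},\qquad \hat r_{j,N}=z_{1-\alpha'/2}\sqrt{\frac{\hat p_{j,N}(1-\hat p_{j,N})}{\sum_{k=1}^J\tau_{k,N}-J}},$$ $\hat P_N=(\hat p_{j,N})_j$, $\hat r_N=(\hat r_{j,N})_j$, and for $P\in\mathscr P(\Xi)$, $r\in\mathbb R_+^J$, $\mathfrak P(P,r)=\{Q\in\mathscr P(\Xi):p_j-r_j\le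 q_j\le p_j+r_j,\ j=1,\dots,J\}$. For $\beta\in[0,1)$ and a probability measure $Q$, $\mathrm{CVaR}^\beta_Q[X]=\inf_{d\in\mathbb R}\{d+\frac1{1-\beta}\mathbb E_Q[(X-d)^+]\}$, with $[x]^+=\max\{x,0\}$. *)

theory Defs
  imports "HOL-Probability.Probability"
begin

(* For the standard normal distribution and q strictly between 0 and 1 this is the
   unique x with cdf M x = q. *)
definition quantile :: "real measure \<Rightarrow> real \<Rightarrow> real" where
  "quantile M q = Inf {x. q \<le> cdf M x}"

(* For beta in [0,1) and integrable X the infimum is taken over a set that is
   bounded below by the expectation of X, so the real-valued infimum is the true one. *)
definition CVaR :: "real \<Rightarrow> 'a measure \<Rightarrow> ('a \<Rightarrow> real) \<Rightarrow> real" where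
  "CVaR \<beta> Q X = (INF d. d + 1 / (1 - \<beta>) * (\<integral>x. max (X x - d) 0 \<partial>Q))"

(* Throughout, the points of the finite sample space are xi 1, ..., xi J; values of
   families indexed by nat outside {1..J} are irrelevant. *)

definition posterior_tau ::
    "(nat \<Rightarrow> 'a) \<Rightarrow> (nat \<Rightarrow> real) \<Rightarrow> (nat \<Rightarrow> 'a) \<Rightarrow> nat \<Rightarrow> nat \<Rightarrow> real" where
  "posterior_tau xi tau0 obs N j = tau0 j + (\<Sum>i=1..N. of_bool (obs i = xi j))"

definition p_hat ::
    "nat \<Rightarrow> (nat \<Rightarrow> 'a) \<Rightarrow> (nat \<Rightarrow> real) \<Rightarrow> (nat \<Rightarrow> 'a) \<Rightarrow> nat \<Rightarrow> nat \<Rightarrow> real" where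
  "p_hat J xi tau0 obs N j =
     (posterior_tau xi tau0 obs N j - 1) /
     ((\<Sum>k=1..J. posterior_tau xi tau0 obs N k) - real J)"

definition r_hat ::
    "real \<Rightarrow> nat \<Rightarrow> (nat \<Rightarrow> 'a) \<Rightarrow> (nat \<Rightarrow> real) \<Rightarrow> (nat \<Rightarrow> 'a) \<Rightarrow> nat \<Rightarrow> nat \<Rightarrow> real" where
  "r_hat \<alpha> J xi tau0 obs N j =
     quantile std_normal_distribution (1 - (\<alpha> / real J) / 2) *
     sqrt (p_hat J xi tau0 obs N j * (1 - p_hat J xi tau0 obs N j) /
           ((\<Sum>k=1..J. posterior_tau xi tau0 obs N k) - real J))"

definition prob_measures :: "'a set \<Rightarrow> 'a pmf set" where
  "prob_measures X = {P. set_pmf P \<subseteq> X}"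

definition ambiguity_set ::
    "nat \<Rightarrow> (nat \<Rightarrow> 'a) \<Rightarrow> (nat \<Rightarrow> real) \<Rightarrow> (nat \<Rightarrow> real) \<Rightarrow> 'a pmf set" where
  "ambiguity_set J xi p r =
     {Q \<in> prob_measures (xi ` {1..J}).
        \<forall>j\<in>{1..J}. p j - r j \<le> pmf Q (xi j) \<and> pmf Q (xi j) \<le> p j + r j}"

(* The probability measure with mass w j at xi j; meaningful when xi is injective on {1..J}
   and w is a probability vector, see the lemmas below. *)
definition pmf_of_weights :: "nat \<Rightarrow> (nat \<Rightarrow> 'a) \<Rightarrow> (nat \<Rightarrow> real) \<Rightarrow> 'a pmf" where
  "pmf_of_weights J xi w = embed_pmf (\<lambda>x. \<Sum>j\<in>{j\<in>{1..J}. xi j = x}. w j)"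

lemma pmf_pmf_of_weights_eq:
  assumes inj: "inj_on xi {1..J}" and nn: "\<And>j. j \<in> {1..J} \<Longrightarrow> 0 \<le> w j"
    and one: "(\<Sum>j=1..J. w j) = 1"
  shows "pmf (pmf_of_weights J xi w) x = (\<Sum>j\<in>{j\<in>{1..J}. xi j = x}. w j)"
  unfolding pmf_of_weights_def
proof (rule pmf_embed_pmf)
  let ?f = "\<lambda>x. \<Sum>j\<in>{j\<in>{1..J}. xi j = x}. w j"
  show nn': "0 \<le> ?f x" for x using nn by (auto intro!: sum_nonneg)
  have z: "?f x = 0" if "x \<notin> xi ` {1..J}" for x
    using that by (intro sum.neutral) auto
  have "(\<integral>\<^sup>+x. ennreal (?f x) \<partial>count_space UNIV) = (\<Sum>x\<in>xi ` {1..J}. ennreal (?f x))"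
    by (rule nn_integral_count_space'[OF finite_imageI]) (use z in auto)
  also have "\<dots> = ennreal (\<Sum>x\<in>xi ` {1..J}. ?f x)"
    using nn' by (intro sum_ennreal) auto
  also have "(\<Sum>x\<in>xi ` {1..J}. ?f x) = (\<Sum>j=1..J. w j)"
    by (rule sum.group) auto
  finally show "(\<integral>\<^sup>+x. ennreal (?f x) \<partial>count_space UNIV) = 1" using one by simp
qed

lemma pmf_pmf_of_weights:
  assumes "inj_on xi {1..J}" "\<And>j. j \<in> {1..J} \<Longrightarrow> 0 \<le> w j" "(\<Sum>j=1..J. w j) = 1"
    and j: "j \<in> {1..J}"
  shows "pmf (pmf_of_weights J xi w) (xi j) = w j"
proof -
  have "{i\<in>{1..J}. xi i = xi j} = {j}" using assms(1) j by (auto dest: inj_onD)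
  then show ?thesis using pmf_pmf_of_weights_eq[OF assms(1-3)] by simp
qed

lemma pmf_of_weights_in_prob_measures:
  assumes "inj_on xi {1..J}" "\<And>j. j \<in> {1..J} \<Longrightarrow> 0 \<le> w j" "(\<Sum>j=1..J. w j) = 1"
  shows "pmf_of_weights J xi w \<in> prob_measures (xi ` {1..J})"
proof -
  have "pmf (pmf_of_weights J xi w) x = 0" if "x \<notin> xi ` {1..J}" for x
    using that by (subst pmf_pmf_of_weights_eq[OF assms]) (auto intro!: sum.neutral)
  then show ?thesis unfolding prob_measures_def by (fastforce simp: set_pmf_iff simp del: One_nat_def)
qed

end

theory Submission
  imports Defs
begin

text \<open>
  Writing \<open>q = l + (q - l)\<close>, the supremum over the box \<open>l \<le> q \<le> u\<close> becomes a fractional knapsack problem: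
  distribute the mass \<open>1 - L\<close> subject to the capacities \<open>u - l\<close>. Weak duality bounds it, for every
  threshold \<open>d\<close>, by \<open>(1 - L) d + \<Sum> (u - l) (f - d)\<^sup>+\<close>, which is \<open>1 - L\<close> times the objective of the CVaR;
  filling the capacities in decreasing order of \<open>f\<close> attains the bound at the critical threshold.
  The radii are nonnegative because a negative quantile would give \<open>l \<ge> p\<close>, hence \<open>L \<ge> 1\<close>.
\<close>

text \<open>Take the largest value of \<open>f\<close> on \<open>I\<close> whose upper level set
  still weighs at least \<open>m\<close>. Its strict upper level set is either empty or the upper
  level set of the next larger value, which weighs less than \<open>m\<close> by maximality.\<close>

lemma critical_threshold:
  fixes f w :: "'i \<Rightarrow> real"
  assumes fin: "finite I" and m: "0 < m" "m \<le> sum w I"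
  obtains d where "sum w {i\<in>I. d < f i} \<le> m" "m \<le> sum w {i\<in>I. d \<le> f i}"
proof -
  define D where "D = {d \<in> f ` I. m \<le> sum w {i\<in>I. d \<le> f i}}"
  have "I \<noteq> {}" using m by auto
  have "finite D" using fin by (simp add: D_def)
  have "{i\<in>I. Min (f ` I) \<le> f i} = I" using fin by auto
  then have "Min (f ` I) \<in> D" using m \<open>I \<noteq> {}\<close> fin by (simp add: D_def)
  then have "Max D \<in> D" using \<open>finite D\<close> Max_in by blast
  have "sum w {i\<in>I. Max D < f i} \<le> m"
  proof (cases "{i\<in>I. Max D < f i} = {}")
    case True
    then show ?thesis using m by (metis less_imp_le sum.empty)
  next
    case False
    define d where "d = Min (f ` {i\<in>I. Max D < f i})"
    have "d \<in> f ` {i\<in>I. Max D < f i}" unfolding d_def using False fin by (intro Min_in) auto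
    then have "d \<in> f ` I" "Max D < d" by auto
    then have "d \<notin> D" using \<open>finite D\<close> by (meson Max_ge leD)
    moreover have "{i\<in>I. d \<le> f i} = {i\<in>I. Max D < f i}"
      using \<open>Max D < d\<close> fin by (auto simp: d_def)
    ultimately show ?thesis using \<open>d \<in> f ` I\<close> by (auto simp: D_def)
  qed
  with \<open>Max D \<in> D\<close> that show thesis by (auto simp: D_def)
qed

text \<open>The threshold \<open>d\<close> is the multiplier of the constraint on
  \<open>sum v I\<close>. Termwise, passing from \<open>f i - d\<close> to its positive part and
  then from \<open>v i\<close> to the capacity \<open>w i\<close> can only increase the
  value.\<close>

lemma knapsack_weak_duality:
  fixes f w v :: "'i \<Rightarrow> real"
  assumes v: "\<And>i. i \<in> I \<Longrightarrow> 0 \<le> v i \<and> v i \<le> w i"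
  shows "(\<Sum>i\<in>I. v i * f i) \<le> sum v I * d + (\<Sum>i\<in>I. w i * max (f i - d) 0)"
proof -
  have "v i * f i \<le> v i * d + w i * max (f i - d) 0" if "i \<in> I" for i
  proof -
    have "v i * (f i - d) \<le> v i * max (f i - d) 0"
      using v[OF that] by (intro mult_left_mono) auto
    also have "\<dots> \<le> w i * max (f i - d) 0"
      using v[OF that] by (intro mult_right_mono) auto
    finally show ?thesis by (simp add: algebra_simps)
  qed
  then show ?thesis by (simp add: sum_distrib_right sum_mono flip: sum.distrib)
qed

text \<open>Complementary slackness at the critical threshold: capacities are full where
  \<open>f\<close> exceeds \<open>d\<close>, empty where it is below, and filled to a common
  fraction \<open>t\<close> on ties. Both weak duality estimates are then equalities in every term,
  whatever \<open>t\<close> is; \<open>t\<close> only adjusts the total mass to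
  \<open>m\<close>.\<close>

lemma knapsack_strong_duality:
  fixes f w :: "'i \<Rightarrow> real"
  assumes fin: "finite I" and w: "\<And>i. i \<in> I \<Longrightarrow> 0 \<le> w i"
    and m: "0 < m" "m \<le> sum w I"
  obtains v d where "\<And>i. i \<in> I \<Longrightarrow> 0 \<le> v i \<and> v i \<le> w i" "sum v I = m"
    "(\<Sum>i\<in>I. v i * f i) = m * d + (\<Sum>i\<in>I. w i * max (f i - d) 0)"
proof -
  obtain d where d: "sum w {i\<in>I. d < f i} \<le> m" "m \<le> sum w {i\<in>I. d \<le> f i}"
    using critical_threshold[OF fin m] by blast
  let ?G = "{i\<in>I. d < f i}" and ?E = "{i\<in>I. f i = d}"
  have "{i\<in>I. d \<le> f i} = ?G \<union> ?E" by auto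
  then have GE: "sum w {i\<in>I. d \<le> f i} = sum w ?G + sum w ?E"
    using fin by (simp add: sum.union_disjoint disjoint_iff)
  \<comment> \<open>If \<open>sum w ?E = 0\<close>, then \<open>t = 0\<close> and \<open>sum w ?G = m\<close>, so no case distinction is needed.\<close>
  define t where "t = (m - sum w ?G) / sum w ?E"
  have t: "0 \<le> t" "t \<le> 1" "t * sum w ?E = m - sum w ?G"
    using d GE by (auto simp: t_def divide_simps)
  define v where "v i = (if d < f i then w i else if f i = d then t * w i else 0)" for i
  have v: "0 \<le> v i \<and> v i \<le> w i" if "i \<in> I" for i
    using t w[OF that] by (auto simp: v_def mult_left_le_one_le)
  have "sum v I = (\<Sum>i\<in>I. (if d < f i then w i else 0) + (if f i = d then t * w i else 0))"
    by (intro sum.cong) (auto simp: v_def)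
  also have "\<dots> = sum w ?G + t * sum w ?E"
    using fin by (simp add: sum.distrib sum_distrib_left flip: sum.inter_filter)
  finally have sv: "sum v I = m" using t by simp
  have "(\<Sum>i\<in>I. v i * f i) = (\<Sum>i\<in>I. v i * d + w i * max (f i - d) 0)"
    by (intro sum.cong) (auto simp: v_def algebra_simps)
  also have "\<dots> = m * d + (\<Sum>i\<in>I. w i * max (f i - d) 0)"
    by (simp add: sum.distrib sv flip: sum_distrib_right)
  finally show thesis using that v sv by blast
qed

lemma expectation_finite_support:
  fixes xi :: "nat \<Rightarrow> 'a"
  assumes "inj_on xi {1..J}" "P \<in> prob_measures (xi ` {1..J})"
  shows "measure_pmf.expectation P h = (\<Sum>j=1..J. pmf P (xi j) * h (xi j))"
proof -
  have "measure_pmf.expectation P h = (\<Sum>x\<in>xi ` {1..J}. pmf P x * h x)"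
    using assms(2)
    by (subst integral_measure_pmf[where A = "xi ` {1..J}"]) (auto simp: prob_measures_def)
  then show ?thesis using assms(1) by (simp add: sum.reindex)
qed

lemma expectation_pmf_of_weights:
  assumes "inj_on xi {1..J}" "\<And>j. j \<in> {1..J} \<Longrightarrow> 0 \<le> w j" "(\<Sum>j=1..J. w j) = 1"
  shows "measure_pmf.expectation (pmf_of_weights J xi w) h = (\<Sum>j=1..J. w j * h (xi j))"
  using expectation_finite_support[OF assms(1) pmf_of_weights_in_prob_measures[OF assms]]
    pmf_pmf_of_weights[OF assms] by simp

lemma sum_pmf_finite_support:
  fixes xi :: "nat \<Rightarrow> 'a"
  assumes "inj_on xi {1..J}" "P \<in> prob_measures (xi ` {1..J})"
  shows "(\<Sum>j=1..J. pmf P (xi j)) = 1"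
  using expectation_finite_support[OF assms, of "\<lambda>_. 1"] by simp

text \<open>Both sides equal the knapsack optimum plus the fixed contribution of \<open>l\<close>.
  With \<open>p\<close> and \<open>r\<close> arbitrary, \<open>lu\<close> supplies the nonnegative
  capacities; the Bayesian estimates matter only for verifying it later.\<close>

lemma SUP_ambiguity_set_eq_CVaR:
  fixes p r l u :: "nat \<Rightarrow> real" and xi :: "nat \<Rightarrow> 'a" and h :: "'a \<Rightarrow> real"
  assumes inj: "inj_on xi {1..J}"
    and lu: "\<And>j. j \<in> {1..J} \<Longrightarrow> l j \<le> u j"
    and l: "l = (\<lambda>j. max 0 (p j - r j))" and u: "u = (\<lambda>j. min 1 (p j + r j))"
    and L: "L = (\<Sum>j=1..J. l j)" "0 < L" "L < 1" and U: "U = (\<Sum>j=1..J. u j)" "1 < U"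
  shows "(SUP P\<in>ambiguity_set J xi p r. measure_pmf.expectation P h) =
    L * measure_pmf.expectation (pmf_of_weights J xi (\<lambda>j. l j / L)) h +
    (1 - L) * CVaR ((U - 1) / (U - L))
      (measure_pmf (pmf_of_weights J xi (\<lambda>j. (u j - l j) / (U - L)))) h"
    (is "?sup = L * ?El + (1 - L) * CVaR ?\<beta> (measure_pmf ?Q) h")
proof -
  let ?I = "{1..J}" and ?f = "\<lambda>j. h (xi j)" and ?w = "\<lambda>j. u j - l j"
  have l0: "0 \<le> l j" for j by (simp add: l)
  have sumw: "sum ?w ?I = U - L" by (simp add: L U sum_subtractf)
  \<comment> \<open>The mass \<open>1 - L\<close> is positive by \<open>L < 1\<close> and fits into
    the total capacity \<open>U - L\<close> by \<open>1 < U\<close>.\<close>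
  obtain v d where v: "\<And>j. j \<in> ?I \<Longrightarrow> 0 \<le> v j \<and> v j \<le> ?w j" "sum v ?I = 1 - L"
    and vd: "(\<Sum>j\<in>?I. v j * ?f j) = (1 - L) * d + (\<Sum>j\<in>?I. ?w j * max (?f j - d) 0)"
    using knapsack_strong_duality[of ?I ?w "1 - L" ?f] lu L U sumw by auto

  have El: "L * ?El = (\<Sum>j\<in>?I. l j * ?f j)"
  proof -
    have "?El = (\<Sum>j\<in>?I. l j / L * ?f j)"
      using L l0 by (intro expectation_pmf_of_weights[OF inj]) (auto simp flip: sum_divide_distrib)
    then show ?thesis using L by (simp add: sum_distrib_left)
  qed
  have EQ: "measure_pmf.expectation ?Q k = (\<Sum>j\<in>?I. ?w j * k (xi j)) / (U - L)" for k
  proof -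
    have "measure_pmf.expectation ?Q k = (\<Sum>j\<in>?I. ?w j / (U - L) * k (xi j))"
      using L U lu sumw by (intro expectation_pmf_of_weights[OF inj])
        (auto simp flip: sum_divide_distrib)
    then show ?thesis by (simp add: sum_divide_distrib)
  qed
  define H where "H d = d + 1 / (1 - ?\<beta>) * (\<integral>x. max (h x - d) 0 \<partial>measure_pmf ?Q)" for d
  \<comment> \<open>The CVaR level is chosen so that
    \<open>1 - ?\<beta> = (1 - L) / (U - L)\<close>: the normalisation \<open>U - L\<close> of
    \<open>?Q\<close> cancels, and the dual objective of the knapsack remains.\<close>
  have H: "(1 - L) * H c = (1 - L) * c + (\<Sum>j\<in>?I. ?w j * max (?f j - c) 0)" for c
  proof -
    have "1 - ?\<beta> = (1 - L) / (U - L)" using L U by (simp add: field_simps)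
    moreover have "(1 - L) * (c + 1 / ((1 - L) / (U - L)) * (x / (U - L))) = (1 - L) * c + x" for x
      using L U by (simp add: distrib_left)
    ultimately show ?thesis unfolding H_def EQ by metis
  qed
  have weak: "(\<Sum>j\<in>?I. v' j * ?f j) \<le> (1 - L) * H c"
    if "\<And>j. j \<in> ?I \<Longrightarrow> 0 \<le> v' j \<and> v' j \<le> ?w j" "sum v' ?I = 1 - L" for v' c
    using knapsack_weak_duality[of ?I v' ?w ?f c] that by (simp add: H)
  have vdH: "(\<Sum>j\<in>?I. v j * ?f j) = (1 - L) * H d" using vd H by simp
  \<comment> \<open>Weak duality for the optimal \<open>v\<close> at an arbitrary \<open>c\<close>
    shows that \<open>d\<close> minimises \<open>H\<close>, so the infimum in CVaR is
    attained.\<close>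
  have "(1 - L) * H d \<le> (1 - L) * H c" for c
    using weak[OF v, of c] vdH by simp
  then have "H d \<le> H c" for c using L by simp
  then have "CVaR ?\<beta> (measure_pmf ?Q) h = H d"
    unfolding CVaR_def H_def[symmetric] by (intro cInf_eq_minimum) auto
  then have rhs: "L * ?El + (1 - L) * CVaR ?\<beta> (measure_pmf ?Q) h =
      (\<Sum>j\<in>?I. (l j + v j) * ?f j)"
    using vdH El by (simp add: distrib_right sum.distrib)

  have "?sup = (\<Sum>j\<in>?I. (l j + v j) * ?f j)"
  proof (rule cSup_eq_maximum)
    let ?P = "pmf_of_weights J xi (\<lambda>j. l j + v j)"
    have nn: "\<And>j. j \<in> ?I \<Longrightarrow> 0 \<le> l j + v j" using v l0 by simp
    have one: "(\<Sum>j\<in>?I. l j + v j) = 1" using v L by (simp add: sum.distrib)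
    have "p j - r j \<le> l j + v j \<and> l j + v j \<le> p j + r j" if "j \<in> ?I" for j
      using v(1)[OF that] by (auto simp: l u)
    then have "?P \<in> ambiguity_set J xi p r"
      unfolding ambiguity_set_def
      using pmf_of_weights_in_prob_measures[OF inj nn one] pmf_pmf_of_weights[OF inj nn one] by simp
    with expectation_pmf_of_weights[OF inj nn one]
    show "(\<Sum>j\<in>?I. (l j + v j) * ?f j)
        \<in> (\<lambda>P. measure_pmf.expectation P h) ` ambiguity_set J xi p r"
      by (metis (no_types, lifting) imageI)
  next
    fix y assume "y \<in> (\<lambda>P. measure_pmf.expectation P h) ` ambiguity_set J xi p r"
    then obtain P where P: "P \<in> prob_measures (xi ` ?I)" and y: "y = measure_pmf.expectation P h"
      and box: "\<And>j. j \<in> ?I \<Longrightarrow> p j - r j \<le> pmf P (xi j) \<and> pmf P (xi j) \<le> p j + r j"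
      by (auto simp: ambiguity_set_def)
    \<comment> \<open>The excess of \<open>P\<close> over \<open>l\<close> is feasible for the
      knapsack. Truncating the box at 0 and 1 loses nothing, because point masses lie in
      [0,1].\<close>
    have "0 \<le> pmf P (xi j) - l j \<and> pmf P (xi j) - l j \<le> ?w j" if "j \<in> ?I" for j
      using box[OF that] by (auto simp: l u pmf_le_1)
    moreover have "(\<Sum>j\<in>?I. pmf P (xi j) - l j) = 1 - L"
      using sum_pmf_finite_support[OF inj P] L by (simp add: sum_subtractf)
    ultimately have "(\<Sum>j\<in>?I. (pmf P (xi j) - l j) * ?f j) \<le> (1 - L) * H d"
      by (rule weak)
    then show "y \<le> (\<Sum>j\<in>?I. (l j + v j) * ?f j)"
      using vdH by (simp add: y expectation_finite_support[OF inj P] distrib_right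
          left_diff_distrib sum.distrib sum_subtractf)
  qed
  then show ?thesis by (simp add: rhs)
qed

lemma posterior_tau_gt_1:
  assumes "tau0 j > 1"
  shows "posterior_tau xi tau0 obs N j > 1"
  using assms sum_nonneg[of "{1..N}" "\<lambda>i. of_bool (obs i = xi j) :: real"]
  by (simp add: posterior_tau_def)

text \<open>The denominator of \<open>p_hat\<close> is the sum of its numerators
  \<open>posterior_tau - 1\<close>, all positive; \<open>p_hat\<close> is the mode of the Dirichlet
  distribution with parameters \<open>posterior_tau\<close>.\<close>

lemma p_hat_prob_vector:
  assumes tau0: "\<And>j. j \<in> {1..J} \<Longrightarrow> tau0 j > 1" and "J \<ge> 1"
  shows "(\<Sum>j=1..J. posterior_tau xi tau0 obs N j) - real J > 0"
    and "j \<in> {1..J} \<Longrightarrow> 0 \<le> p_hat J xi tau0 obs N j"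
    and "(\<Sum>j=1..J. p_hat J xi tau0 obs N j) = 1"
proof -
  let ?tau = "posterior_tau xi tau0 obs N"
  have eq: "(\<Sum>j=1..J. ?tau j - 1) = (\<Sum>j=1..J. ?tau j) - real J"
    by (simp add: sum_subtractf)
  have "(\<Sum>j=1..J. ?tau j - 1) > 0"
    using tau0 \<open>J \<ge> 1\<close> by (intro sum_pos) (auto simp: posterior_tau_gt_1)
  then show pos: "(\<Sum>j=1..J. ?tau j) - real J > 0" unfolding eq .
  show "0 \<le> p_hat J xi tau0 obs N j" if "j \<in> {1..J}"
    unfolding p_hat_def using posterior_tau_gt_1[of tau0 j] tau0[OF that] pos
    by (intro divide_nonneg_pos) (auto intro: less_imp_le)
  show "(\<Sum>j=1..J. p_hat J xi tau0 obs N j) = 1"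
    using pos unfolding p_hat_def sum_divide_distrib[symmetric] eq by simp
qed

theorem theorem1:
  fixes S :: "(real ^ 'm) set" and A :: "(real ^ 'n) set"
    and J :: nat and xi :: "nat \<Rightarrow> real ^ 'k"
    and C :: "real ^ 'm \<Rightarrow> real ^ 'n \<Rightarrow> real ^ 'k \<Rightarrow> real"
    and g :: "real ^ 'm \<Rightarrow> real ^ 'n \<Rightarrow> real ^ 'k \<Rightarrow> real ^ 'm"
    and \<gamma> \<alpha> L U :: real
    and tau0 :: "nat \<Rightarrow> real" and N :: nat and obs :: "nat \<Rightarrow> real ^ 'k"
    and p r p_l p_u :: "nat \<Rightarrow> real"
    and P_l P_ul :: "(real ^ 'k) pmf"
    and V :: "real ^ 'm \<Rightarrow> real"
    and s :: "real ^ 'm" and a :: "real ^ 'n"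
  assumes "S \<noteq> {}" and "closed S" and "A \<noteq> {}" and "closed A"
    and "inj_on xi {1..J}"
    and "\<And>s a x. s \<in> S \<Longrightarrow> a \<in> A \<Longrightarrow> x \<in> xi ` {1..J} \<Longrightarrow> g s a x \<in> S"
    and "0 \<le> \<gamma>" and "\<gamma> < 1"
    and "\<And>j. j \<in> {1..J} \<Longrightarrow> tau0 j > 1"
    and "\<And>i. i \<in> {1..N} \<Longrightarrow> obs i \<in> xi ` {1..J}"
    and "0 < \<alpha>" and "\<alpha> < 1"
    and "p = p_hat J xi tau0 obs N"
    and "r = r_hat \<alpha> J xi tau0 obs N"
    and "p_l = (\<lambda>j. max 0 (p j - r j))"
    and "p_u = (\<lambda>j. min 1 (p j + r j))"
    and "L = (\<Sum>k=1..J. p_l k)" and "0 < L" and "L < 1"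
    and "U = (\<Sum>k=1..J. p_u k)" and "1 < U"
    and "P_l = pmf_of_weights J xi (\<lambda>j. p_l j / L)"
    and "P_ul = pmf_of_weights J xi (\<lambda>j. (p_u j - p_l j) / (U - L))"
    and "s \<in> S" and "a \<in> A"
  shows "(SUP P\<in>ambiguity_set J xi p r.
            measure_pmf.expectation P (\<lambda>x. C s a x + \<gamma> * V (g s a x))) =
         L * measure_pmf.expectation P_l (\<lambda>x. C s a x + \<gamma> * V (g s a x)) +
         (1 - L) * CVaR ((U - 1) / (U - L)) (measure_pmf P_ul)
           (\<lambda>x. C s a x + \<gamma> * V (g s a x))"
proof -
  \<comment> \<open>For \<open>J = 0\<close> the empty sum would give \<open>L = 0\<close>.\<close>
  have "J \<ge> 1" using assms(17,18) by (cases J) auto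
  note pv = p_hat_prob_vector[where ?tau0.0 = tau0 and xi = xi and obs = obs and N = N,
      OF assms(9) \<open>J \<ge> 1\<close>, folded assms(13)]
  have p1: "p j \<le> 1" if "j \<in> {1..J}" for j
    using member_le_sum[of j "{1..J}" p] pv that by simp
  \<comment> \<open>The factor \<open>z\<close> is common to all coordinates, so its sign decides
    the sign of all radii at once.\<close>
  define z where "z = quantile std_normal_distribution (1 - (\<alpha> / real J) / 2)"
  define \<sigma> where "\<sigma> j = sqrt (p j * (1 - p j) /
    ((\<Sum>k=1..J. posterior_tau xi tau0 obs N k) - real J))" for j
  have r: "r j = z * \<sigma> j" for j by (simp add: assms(13,14) r_hat_def z_def \<sigma>_def)
  have \<sigma>: "0 \<le> \<sigma> j" if "j \<in> {1..J}" for j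
    unfolding \<sigma>_def using pv p1 that by (simp add: less_imp_le)
  have "0 \<le> z"
  proof (rule ccontr)
    assume "\<not> 0 \<le> z"
    then have "r j \<le> 0" if "j \<in> {1..J}" for j
      using \<sigma>[OF that] by (simp add: r mult_nonpos_nonneg)
    then have "(\<Sum>j=1..J. p j) \<le> L"
      unfolding assms(17) by (intro sum_mono) (fastforce simp: assms(15))
    then show False using pv assms(19) by simp
  qed
  \<comment> \<open>All four comparisons between the entries of the max and of the min follow from
    \<open>p j\<close> in [0,1] and a nonnegative radius.\<close>
  then have "p_l j \<le> p_u j" if "j \<in> {1..J}" for j
    using pv p1 \<sigma> that unfolding assms(15,16) r by (simp add: add_nonneg_nonneg mult_nonneg_nonneg
      add_increasing2 diff_le_eq)
  then show ?thesis
    unfolding assms(22,23) by (intro SUP_ambiguity_set_eq_CVaR) (use assms in blast)+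
qed

end
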